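(* Let $(X,d,\mu)$ be a measured metric space and let $f:(0,\infty)\to\mathbb{R}$ be a non-decreasing function such that $$\frac{\mu(B(x,R))}{\mu(B(x,\frac12))}\le f(R)\qquad \forall x\in X,\ \forall R\ge \tfrac12 .$$ Let $\sigma\ge 1$ and suppose $(X,d,\mu)$ satisfies the local Poincaré inequality $P_{loc}$ with exponent $\sigma$, constant $C>0$ and some $r_0\ge 1$. Then for every $u\in C(X)$, every upper gradient $g_u$ of $u$ and every $x\in X$, $$\int_{B(x,R)}|u-u_R|^{\sigma}\,d\mu\ \le\ C_0\,R^{\sigma-1}f(4\lambda R)\int_{B(x,2\lambda R)}g_u^{\sigma}\,d\mu\qquad \forall R\ge 4\lambda,$$ where $\lambda=f(8.5)+1$ and $C_0=2^{4\sigma-2}\lambda^{3}f(12.5)\,C$.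
   Context: A measured metric space $(X,d,\mu)$ is a proper geodesic metric space $(X,d)$ (all closed balls are compact and any two points can be joined by a geodesic) together with a Borel measure $\mu$ on $X$ such that every closed ball has finite positive measure. $B(x,R)$ is the open ball of radius $R$ about $x$. $C(X)$ is the space of continuous real functions on $X$. An upper gradient of $u\in C(X)$ is a Borel function $g_u:X\to[0,\infty]$ such that for each curve $\gamma:[0,1]\to X$ of finite length $l(\gamma)$ and constant speed, $|u(\gamma(1))-u(\gamma(0))|\le l(\gamma)\int_0^1 g_u(\gamma(t))\,dt$. $u_R(x)=\frac{1}{\mu(B(x,R))}\int_{B(x,R)}u\,d\mu$; inside an integral over $B(x,R)$, $u_R$ denotes the constant $u_R(x)$. $P_{loc}$ with exponent $\sigma$, constant $C$ and radius $r_0>0$: for every $u\in C(X)$ and every upper gradient $g_u$ of $u$, $\int_{B(x,R)}|u-u_R|^{\sigma}d\mu\le C\int_{B(x,R)}g_u^{\sigma}d\mu$ for all $x\in X$ and $0<R\le r_0$. *)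

theory Defs
  imports "HOL-Analysis.Analysis"
begin

definition geodesic_joining :: "(real \<Rightarrow> 'a::metric_space) \<Rightarrow> 'a \<Rightarrow> 'a \<Rightarrow> bool" where
  "geodesic_joining \<gamma> x y \<longleftrightarrow>
     \<gamma> 0 = x \<and> \<gamma> (dist x y) = y \<and>
     (\<forall>s\<in>{0..dist x y}. \<forall>t\<in>{0..dist x y}. dist (\<gamma> s) (\<gamma> t) = \<bar>s - t\<bar>)"

text \<open>The positivity of the measure is required only for closed balls of positive radius: a ball of
  radius 0 is a single point, and points may be null sets (as for Lebesgue measure).\<close>

definition measured_metric_space :: "'a::metric_space measure \<Rightarrow> bool" where
  "measured_metric_space \<mu> \<longleftrightarrow>
     (\<forall>(x::'a) r. compact (cball x r)) \<and>
     (\<forall>x y::'a. \<exists>\<gamma>. geodesic_joining \<gamma> x y) \<and>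
     sets \<mu> = sets borel \<and>
     (\<forall>x r. r > 0 \<longrightarrow> 0 < emeasure \<mu> (cball x r) \<and> emeasure \<mu> (cball x r) < \<infinity>)"

text \<open>Length of the restriction of a curve to \<open>{a..b}\<close>: the supremum of the lengths of inscribed
  polygons over all finite subdivisions, given as sorted lists of parameters.\<close>

definition curve_length :: "(real \<Rightarrow> 'a::metric_space) \<Rightarrow> real \<Rightarrow> real \<Rightarrow> ennreal" where
  "curve_length \<gamma> a b =
     (SUP ts \<in> {ts. sorted ts \<and> set ts \<subseteq> {a..b}}.
        \<Sum>i<length ts - 1. ennreal (dist (\<gamma> (ts ! i)) (\<gamma> (ts ! Suc i))))"

definition constant_speed :: "(real \<Rightarrow> 'a::metric_space) \<Rightarrow> bool" where
  "constant_speed \<gamma> \<longleftrightarrow>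
     (\<forall>s t. 0 \<le> s \<and> s \<le> t \<and> t \<le> 1 \<longrightarrow>
        curve_length \<gamma> s t = ennreal (t - s) * curve_length \<gamma> 0 1)"

definition upper_gradient :: "('a::metric_space \<Rightarrow> real) \<Rightarrow> ('a \<Rightarrow> ennreal) \<Rightarrow> bool" where
  "upper_gradient u g \<longleftrightarrow>
     g \<in> borel_measurable borel \<and>
     (\<forall>\<gamma>. continuous_on {0..1} \<gamma> \<and> curve_length \<gamma> 0 1 < \<infinity> \<and> constant_speed \<gamma> \<longrightarrow>
        ennreal \<bar>u (\<gamma> 1) - u (\<gamma> 0)\<bar>
          \<le> curve_length \<gamma> 0 1 * (\<integral>\<^sup>+ t \<in> {0..1}. g (\<gamma> t) \<partial>lborel))"

definition ball_avg :: "'a::metric_space measure \<Rightarrow> ('a \<Rightarrow> real) \<Rightarrow> 'a \<Rightarrow> real \<Rightarrow> real" where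
  "ball_avg \<mu> u x R = (1 / measure \<mu> (ball x R)) * (LINT y:ball x R|\<mu>. u y)"

text \<open>Powers of \<open>[0,\<infinity>]\<close>-valued functions, with \<open>\<infinity>\<^sup>\<sigma> = \<infinity>\<close>; meant for exponents \<open>\<sigma> > 0\<close>.\<close>

definition ennreal_powr :: "ennreal \<Rightarrow> real \<Rightarrow> ennreal" where
  "ennreal_powr a \<sigma> = (if a = \<infinity> then \<infinity> else ennreal (enn2real a powr \<sigma>))"

definition P_loc :: "'a::metric_space measure \<Rightarrow> real \<Rightarrow> real \<Rightarrow> real \<Rightarrow> bool" where
  "P_loc \<mu> \<sigma> C r0 \<longleftrightarrow>
     (\<forall>u g. continuous_on UNIV u \<and> upper_gradient u g \<longrightarrow>
        (\<forall>x R. 0 < R \<and> R \<le> r0 \<longrightarrow>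
           (\<integral>\<^sup>+ y \<in> ball x R. ennreal (\<bar>u y - ball_avg \<mu> u x R\<bar> powr \<sigma>) \<partial>\<mu>)
             \<le> ennreal C * (\<integral>\<^sup>+ y \<in> ball x R. ennreal_powr (g y) \<sigma> \<partial>\<mu>)))"

end

theory Submission
  imports Defs
begin

text \<open>Compare \<open>u\<close> with the single constant \<open>c\<close>, its average over \<open>B(x,1)\<close>. Cover \<open>B(x,R)\<close> by unit balls
  around a maximal 1-separated set; the growth condition bounds their overlap by \<open>f(5/2)\<close>, and on
  each of them the local inequality controls the deviation of \<open>u\<close> from the average \<open>u\<^sub>p\<close> over \<open>B(p,1)\<close>.
  To bound \<open>\<bar>u\<^sub>p - c\<bar>\<close>, walk along a geodesic from \<open>x\<close> to \<open>p\<close> with unit steps. Two consecutive unit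
  balls both contain the ball of radius \<open>1/2\<close> about the midpoint \<open>m\<close> of their centres, which bounds the
  difference of their averages, with \<open>\<mu>(B(x,R+1)) \<le> f(2R+2) \<mu>(B(m,1/2))\<close> as the normalization.
  Hoelder's inequality over the at most \<open>2R\<close> steps produces \<open>R\<^bsup>\<sigma>-1\<^esup>\<close>. Since the centres lie on a
  geodesic, the unit balls along it have bounded overlap, so the energies add up to at most five
  times the energy of \<open>B(x,R+1)\<close>.\<close>

section \<open>Convexity of powers\<close>

text \<open>Young's inequality in disguise. Averaged over \<open>v\<close> with mean \<open>a\<close>, it yields Jensen's inequality.\<close>

lemma powr_above_tangent:
  fixes a v \<sigma> :: real
  assumes "\<sigma> \<ge> 1" "a \<ge> 0" "v \<ge> 0"
  shows "a powr \<sigma> + \<sigma> * a powr (\<sigma> - 1) * (v - a) \<le> v powr \<sigma>"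
\<comment> \<open>Young's inequality is kept for positive \<open>a\<close> and \<open>v\<close>. At
  \<open>a = 0\<close> the slope is 0 even for \<open>\<sigma> = 1\<close>, since
  \<open>0 powr s = 0\<close> for every \<open>s\<close>.\<close>
proof (cases "a = 0 \<or> v = 0")
  case True
  then show ?thesis
  proof
    assume "v = 0"
    moreover have "a powr (\<sigma> - 1) * a = a powr \<sigma>" if "a > 0"
      using that powr_mult_base[of a "\<sigma> - 1"] by (simp add: mult.commute)
    ultimately show ?thesis
      using assms mult_right_mono[of 1 \<sigma> "a powr \<sigma>"]
      by (cases "a = 0") (auto simp: algebra_simps)
  qed auto
next
  case False
  then have pos: "a > 0" "v > 0"
    using assms by auto
  have "(v powr \<sigma>) powr (1/\<sigma>) * (a powr \<sigma>) powr (1 - 1/\<sigma>)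
      \<le> (1/\<sigma>) * v powr \<sigma> + (1 - 1/\<sigma>) * a powr \<sigma>"
    using assms pos by (intro Youngs_inequality_0) (auto simp: field_simps)
  also have "(v powr \<sigma>) powr (1/\<sigma>) = v"
    using assms pos by (simp add: powr_powr)
  also have "(a powr \<sigma>) powr (1 - 1/\<sigma>) = a powr (\<sigma> - 1)"
    using assms by (simp add: powr_powr algebra_simps)
  finally have "\<sigma> * (v * a powr (\<sigma> - 1)) \<le> \<sigma> * ((1/\<sigma>) * v powr \<sigma> + (1 - 1/\<sigma>) * a powr \<sigma>)"
    using assms by (intro mult_left_mono) auto
  also have "\<dots> = v powr \<sigma> + (\<sigma> - 1) * a powr \<sigma>"
    using assms by (simp add: field_simps)
  finally have "\<sigma> * (v * a powr (\<sigma> - 1)) \<le> v powr \<sigma> + (\<sigma> - 1) * a powr \<sigma>" .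
  moreover have "a powr \<sigma> = a powr (\<sigma> - 1) * a"
    using pos powr_mult_base[of a "\<sigma> - 1"] by (simp add: mult.commute)
  ultimately show ?thesis
    by (simp add: algebra_simps)
qed

text \<open>Sum the tangent inequality taken at the arithmetic mean \<open>m\<close>: the linear
  terms cancel and \<open>n * m powr \<sigma>\<close> remains. This is Hoelder's inequality against
  the constant 1.\<close>

lemma powr_sum_le:
  fixes a :: "'i \<Rightarrow> real"
  assumes "\<sigma> \<ge> 1" "finite I" "\<And>i. i \<in> I \<Longrightarrow> a i \<ge> 0"
  shows "(\<Sum>i\<in>I. a i) powr \<sigma> \<le> real (card I) powr (\<sigma> - 1) * (\<Sum>i\<in>I. a i powr \<sigma>)"
proof (cases "I = {}")
  case False
  define n where "n = real (card I)"
  define m where "m = (\<Sum>i\<in>I. a i) / n"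
  have n: "n > 0"
    using False assms by (simp add: n_def card_gt_0_iff)
  have m: "m \<ge> 0"
    unfolding m_def using n assms by (auto intro!: divide_nonneg_pos sum_nonneg)
  have s: "(\<Sum>i\<in>I. a i) = n * m"
    using n by (simp add: m_def)
  have "(\<Sum>i\<in>I. m powr \<sigma> + \<sigma> * m powr (\<sigma> - 1) * (a i - m)) \<le> (\<Sum>i\<in>I. a i powr \<sigma>)"
    using assms m by (intro sum_mono powr_above_tangent) auto
  also have "(\<Sum>i\<in>I. m powr \<sigma> + \<sigma> * m powr (\<sigma> - 1) * (a i - m)) = n * m powr \<sigma>"
    by (simp add: sum.distrib sum_subtractf s n_def flip: sum_distrib_left)
  finally have "n powr (\<sigma> - 1) * (n * m powr \<sigma>) \<le> n powr (\<sigma> - 1) * (\<Sum>i\<in>I. a i powr \<sigma>)"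
    by (intro mult_left_mono) auto
  moreover have "n powr \<sigma> = n powr (\<sigma> - 1) * n"
    using n powr_mult_base[of n "\<sigma> - 1"] by (simp add: mult.commute)
  ultimately show ?thesis
    using n m by (simp add: s powr_mult mult.assoc flip: n_def)
qed auto

lemma abs_powr_diff_le:
  fixes a b c \<sigma> :: real
  assumes "\<sigma> \<ge> 1"
  shows "\<bar>a - b\<bar> powr \<sigma> \<le> 2 powr (\<sigma> - 1) * (\<bar>a - c\<bar> powr \<sigma> + \<bar>c - b\<bar> powr \<sigma>)"
proof -
  have "\<bar>a - b\<bar> powr \<sigma> \<le> (\<bar>a - c\<bar> + \<bar>c - b\<bar>) powr \<sigma>"
    using assms by (intro powr_mono2) auto
  also have "\<dots> \<le> 2 powr (\<sigma> - 1) * (\<bar>a - c\<bar> powr \<sigma> + \<bar>c - b\<bar> powr \<sigma>)"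
    using powr_sum_le[of \<sigma> "{False, True}" "\<lambda>i. if i then \<bar>a - c\<bar> else \<bar>c - b\<bar>"] assms
    by (simp add: add.commute)
  finally show ?thesis .
qed

section \<open>Overlapping sets, balls and averages over balls\<close>

text \<open>After exchanging sum and integral, a point contributes \<open>h y\<close> once for each
  set containing it. This serves for the energies of net balls and of balls along a geodesic, and
  with \<open>h = 1\<close> for the measures of net balls.\<close>

lemma sum_nn_integral_overlap_le:
  assumes "finite I" "h \<in> borel_measurable M" "S \<in> sets M"
    and "\<And>i. i \<in> I \<Longrightarrow> A i \<in> sets M" "\<And>i. i \<in> I \<Longrightarrow> A i \<subseteq> S"
    and "\<And>w. w \<in> S \<Longrightarrow> real (card {i\<in>I. w \<in> A i}) \<le> K"
  shows "(\<Sum>i\<in>I. \<integral>\<^sup>+ y \<in> A i. h y \<partial>M) \<le> ennreal K * (\<integral>\<^sup>+ y \<in> S. h y \<partial>M)"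
proof -
  have "(\<Sum>i\<in>I. \<integral>\<^sup>+ y \<in> A i. h y \<partial>M) = (\<integral>\<^sup>+ y. (\<Sum>i\<in>I. h y * indicator (A i) y) \<partial>M)"
    using assms by (subst nn_integral_sum) auto
  also have "\<dots> \<le> (\<integral>\<^sup>+ y. ennreal K * (h y * indicator S y) \<partial>M)"
  proof (intro nn_integral_mono)
    fix y
    have "(\<Sum>i\<in>I. h y * indicator (A i) y) = h y * of_nat (card {i\<in>I. y \<in> A i})"
      using assms(1) by (simp add: indicator_def sum.If_cases Int_def mult.commute
          flip: sum_distrib_left of_nat_sum)
    also have "\<dots> \<le> ennreal K * (h y * indicator S y)"
    proof (cases "y \<in> S")
      case True
      then have "of_nat (card {i\<in>I. y \<in> A i}) \<le> ennreal K"
        using assms(6)[OF True] by (metis ennreal_leI ennreal_of_nat_eq_real_of_nat)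
      then have "h y * of_nat (card {i\<in>I. y \<in> A i}) \<le> h y * ennreal K"
        by (rule mult_left_mono) simp
      then show ?thesis
        using True by (simp add: mult.commute)
    next
      case False
      then have "{i\<in>I. y \<in> A i} = {}"
        using assms(5) by auto
      then show ?thesis
        by (metis card.empty of_nat_0 mult_zero_right zero_le)
    qed
    finally show "(\<Sum>i\<in>I. h y * indicator (A i) y) \<le> ennreal K * (h y * indicator S y)" .
  qed
  also have "\<dots> = ennreal K * (\<integral>\<^sup>+ y \<in> S. h y \<partial>M)"
    using assms by (intro nn_integral_cmult) auto
  finally show ?thesis .
qed

lemma ball_subset_ballI:
  assumes "dist w p + r \<le> r'"
  shows "ball w r \<subseteq> ball p r'"
proof
  fix y assume "y \<in> ball w r"
  then show "y \<in> ball p r'"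
    using assms dist_triangle[of p y w] by (simp add: dist_commute)
qed

text \<open>The hypotheses concern closed balls. An open ball lies in the closed ball of the same
  radius and contains the one of half the radius; for \<open>r \<le> 0\<close> it is empty.\<close>

lemma measured_metric_space_ball:
  fixes z :: "'a::metric_space"
  assumes "measured_metric_space \<mu>"
  shows "ball z r \<in> sets \<mu>" "emeasure \<mu> (ball z r) = ennreal (measure \<mu> (ball z r))"
    "r > 0 \<Longrightarrow> measure \<mu> (ball z r) > 0"
proof -
  have sets: "sets \<mu> = sets borel"
    using assms by (simp add: measured_metric_space_def)
  then show [measurable]: "ball z r \<in> sets \<mu>"
    by simp
  have fin: "emeasure \<mu> (ball z r) < \<infinity>" if "r > 0" for r
  proof -
    have "emeasure \<mu> (ball z r) \<le> emeasure \<mu> (cball z r)"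
      using sets by (intro emeasure_mono) auto
    then show ?thesis
      using assms that by (auto simp: measured_metric_space_def intro: le_less_trans)
  qed
  show eq: "emeasure \<mu> (ball z r) = ennreal (measure \<mu> (ball z r))"
    using fin[of r] by (cases "r > 0") (auto simp: emeasure_eq_ennreal_measure ball_empty not_less)
  assume r: "r > 0"
  have "0 < emeasure \<mu> (cball z (r/2))"
    using assms r by (auto simp: measured_metric_space_def)
  also have "\<dots> \<le> emeasure \<mu> (ball z r)"
    using r sets by (intro emeasure_mono) auto
  finally show "measure \<mu> (ball z r) > 0"
    by (simp add: eq)
qed

lemma continuous_measurable_mms:
  fixes u :: "'a::metric_space \<Rightarrow> real"
  assumes "measured_metric_space \<mu>" "continuous_on UNIV u"
  shows "u \<in> borel_measurable \<mu>"
  using assms borel_measurable_continuous_onI[of u]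
  by (simp add: measured_metric_space_def cong: measurable_cong_sets)

text \<open>Properness makes \<open>u\<close> bounded on the ball, which has finite measure. Hence
  \<open>ball_avg\<close> is a genuine mean, not one built on the default value 0 of a divergent
  integral.\<close>

lemma continuous_set_integrable_ball:
  fixes u :: "'a::metric_space \<Rightarrow> real"
  assumes mms: "measured_metric_space \<mu>" and cont: "continuous_on UNIV u"
  shows "set_integrable \<mu> (ball z r) u"
proof -
  have "compact (u ` cball z r)"
    using assms by (intro compact_continuous_image)
      (auto simp: measured_metric_space_def intro: continuous_on_subset)
  then obtain B where B: "\<And>y. y \<in> cball z r \<Longrightarrow> norm (u y) \<le> B"
    using compact_imp_bounded by (fastforce simp: bounded_iff)
  have "integrable \<mu> (\<lambda>y. indicator (ball z r) y *\<^sub>R u y)"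
  proof (rule integrableI_bounded_set[where A = "ball z r" and B = B])
    show "(\<lambda>y. indicator (ball z r) y *\<^sub>R u y) \<in> borel_measurable \<mu>"
      using measured_metric_space_ball(1)[OF mms] continuous_measurable_mms[OF assms] by simp
    show "AE y in \<mu>. y \<in> ball z r \<longrightarrow> norm (indicator (ball z r) y *\<^sub>R u y) \<le> B"
      using B by (intro AE_I2) (auto simp: indicator_def)
  qed (use measured_metric_space_ball[OF mms] in auto)
  then show ?thesis
    by (simp add: set_integrable_def)
qed

text \<open>Jensen's inequality: the tangent inequality at the mean \<open>m\<close> of
  \<open>\<bar>u y - c\<bar>\<close> is integrated over the ball. It bounds the cost of replacing a
  constant \<open>c\<close> by the average of \<open>u\<close>.\<close>

lemma ball_avg_deviation_powr_le:
  fixes u :: "'a::metric_space \<Rightarrow> real"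
  assumes mms: "measured_metric_space \<mu>" and cont: "continuous_on UNIV u"
    and \<sigma>: "\<sigma> \<ge> 1" and r: "r > 0"
  shows "ennreal (measure \<mu> (ball x r) * \<bar>ball_avg \<mu> u x r - c\<bar> powr \<sigma>)
    \<le> (\<integral>\<^sup>+ y \<in> ball x r. ennreal (\<bar>u y - c\<bar> powr \<sigma>) \<partial>\<mu>)"
proof -
  note ball = measured_metric_space_ball[OF mms, where z = x and r = r]
  define M where "M = measure \<mu> (ball x r)"
  have M: "M > 0"
    using ball(3) r by (simp add: M_def)
  note int = continuous_set_integrable_ball[OF mms, of _ x r]
  have i1: "set_integrable \<mu> (ball x r) u"
    and i2: "set_integrable \<mu> (ball x r) (\<lambda>y. \<bar>u y - c\<bar>)"
    and i3: "set_integrable \<mu> (ball x r) (\<lambda>y. \<bar>u y - c\<bar> powr \<sigma>)"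
    and i4: "set_integrable \<mu> (ball x r) (\<lambda>y. u y - c)"
    and ic: "\<And>k. set_integrable \<mu> (ball x r) (\<lambda>y. k::real)"
    using \<sigma> by (auto intro!: int continuous_intros cont continuous_on_powr')
  have const: "(LINT y:ball x r|\<mu>. k) = M * k" for k :: real
    using ball by (simp add: set_lebesgue_integral_def M_def)
  define m where "m = (LINT y:ball x r|\<mu>. \<bar>u y - c\<bar>) / M"
  have m: "m \<ge> 0"
    unfolding m_def using M by (intro divide_nonneg_pos) (auto simp: set_lebesgue_integral_def)
  have "ball_avg \<mu> u x r - c = (LINT y:ball x r|\<mu>. u y - c) / M"
    using M i1 ic[of c] const[of c]
    by (simp add: ball_avg_def M_def[symmetric] set_integral_diff field_simps)
  moreover have "\<bar>LINT y:ball x r|\<mu>. u y - c\<bar> \<le> (LINT y:ball x r|\<mu>. \<bar>u y - c\<bar>)"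
    using set_integral_norm_bound[OF i4] by simp
  ultimately have "\<bar>ball_avg \<mu> u x r - c\<bar> \<le> m"
    using M by (simp add: m_def divide_right_mono)
  then have "M * \<bar>ball_avg \<mu> u x r - c\<bar> powr \<sigma> \<le> M * m powr \<sigma>"
    using M \<sigma> by (intro mult_left_mono powr_mono2) auto
  \<comment> \<open>The integrand is the tangent at \<open>m\<close>, evaluated at
    \<open>\<bar>u y - c\<bar>\<close>. Its linear part integrates to 0 because \<open>m\<close> is
    the mean of that function.\<close>
  also have "\<dots> = (LINT y:ball x r|\<mu>. (m powr \<sigma> - \<sigma> * m powr (\<sigma> - 1) * m) + \<sigma> * m powr (\<sigma> - 1) * \<bar>u y - c\<bar>)"
    using M i2 ic const by (subst set_integral_add) (auto simp: m_def field_simps)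
  also have "\<dots> \<le> (LINT y:ball x r|\<mu>. \<bar>u y - c\<bar> powr \<sigma>)"
    using powr_above_tangent[OF \<sigma> m, of "\<bar>u _ - c\<bar>"] i2 i3 ic
    by (intro set_integral_mono) (auto simp: algebra_simps)
  finally have "ennreal (M * \<bar>ball_avg \<mu> u x r - c\<bar> powr \<sigma>)
      \<le> ennreal (LINT y:ball x r|\<mu>. \<bar>u y - c\<bar> powr \<sigma>)"
    by (rule ennreal_leI)
  also have "\<dots> = (\<integral>\<^sup>+ y \<in> ball x r. ennreal (\<bar>u y - c\<bar> powr \<sigma>) \<partial>\<mu>)"
    using i3 unfolding set_lebesgue_integral_def set_integrable_def
    by (subst nn_integral_eq_integral[symmetric])
      (auto intro!: nn_integral_cong simp: indicator_def)
  finally show ?thesis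
    by (simp add: M_def)
qed

text \<open>Changes the constant to which \<open>u\<close> is compared. It is used to pass from the
  average over a net ball to that over \<open>ball x 1\<close>, and from there to the average over
  \<open>ball x R\<close>.\<close>

lemma set_nn_integral_powr_le:
  fixes u :: "'a \<Rightarrow> real"
  assumes "\<sigma> \<ge> 1" "u \<in> borel_measurable M" "A \<in> sets M"
  shows "(\<integral>\<^sup>+ y \<in> A. ennreal (\<bar>u y - b\<bar> powr \<sigma>) \<partial>M)
    \<le> ennreal (2 powr (\<sigma> - 1))
      * ((\<integral>\<^sup>+ y \<in> A. ennreal (\<bar>u y - c\<bar> powr \<sigma>) \<partial>M) + ennreal (\<bar>c - b\<bar> powr \<sigma>) * emeasure M A)"
proof -
  have "(\<integral>\<^sup>+ y \<in> A. ennreal (\<bar>u y - b\<bar> powr \<sigma>) \<partial>M)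
      \<le> (\<integral>\<^sup>+ y. ennreal (2 powr (\<sigma> - 1)) * (ennreal (\<bar>u y - c\<bar> powr \<sigma>) * indicator A y
          + ennreal (\<bar>c - b\<bar> powr \<sigma>) * indicator A y) \<partial>M)"
    using abs_powr_diff_le[OF assms(1)]
    by (intro nn_integral_mono)
      (auto simp: indicator_def ennreal_mult' [symmetric] ennreal_plus[symmetric]
        simp del: ennreal_plus intro!: ennreal_leI)
  also have "\<dots> = ennreal (2 powr (\<sigma> - 1))
      * ((\<integral>\<^sup>+ y \<in> A. ennreal (\<bar>u y - c\<bar> powr \<sigma>) \<partial>M) + ennreal (\<bar>c - b\<bar> powr \<sigma>) * emeasure M A)"
    using assms by (simp add: nn_integral_cmult nn_integral_add)
  finally show ?thesis .
qed

text \<open>Here \<open>u\<close> is the intermediate point: two constants that are both close to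
  \<open>u\<close> on a common set \<open>A\<close> are close to each other.\<close>

lemma powr_emeasure_le:
  fixes u :: "'a \<Rightarrow> real"
  assumes "\<sigma> \<ge> 1" "u \<in> borel_measurable M" "A \<in> sets M"
  shows "ennreal (\<bar>a - b\<bar> powr \<sigma>) * emeasure M A
    \<le> ennreal (2 powr (\<sigma> - 1))
      * ((\<integral>\<^sup>+ y \<in> A. ennreal (\<bar>u y - a\<bar> powr \<sigma>) \<partial>M) + (\<integral>\<^sup>+ y \<in> A. ennreal (\<bar>u y - b\<bar> powr \<sigma>) \<partial>M))"
proof -
  have "ennreal (\<bar>a - b\<bar> powr \<sigma>) * emeasure M A = (\<integral>\<^sup>+ y. ennreal (\<bar>a - b\<bar> powr \<sigma>) * indicator A y \<partial>M)"
    using assms by (simp add: nn_integral_cmult_indicator)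
  also have "\<dots> \<le> (\<integral>\<^sup>+ y. ennreal (2 powr (\<sigma> - 1)) * (ennreal (\<bar>u y - a\<bar> powr \<sigma>) * indicator A y
          + ennreal (\<bar>u y - b\<bar> powr \<sigma>) * indicator A y) \<partial>M)"
    using abs_powr_diff_le[OF assms(1), of a b "u _"]
    by (intro nn_integral_mono)
      (auto simp: indicator_def ennreal_mult' [symmetric] ennreal_plus[symmetric] abs_minus_commute
        simp del: ennreal_plus intro!: ennreal_leI)
  also have "\<dots> = ennreal (2 powr (\<sigma> - 1))
      * ((\<integral>\<^sup>+ y \<in> A. ennreal (\<bar>u y - a\<bar> powr \<sigma>) \<partial>M) + (\<integral>\<^sup>+ y \<in> A. ennreal (\<bar>u y - b\<bar> powr \<sigma>) \<partial>M))"
    using assms by (simp add: nn_integral_cmult nn_integral_add)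
  finally show ?thesis .
qed

section \<open>Consequences of the growth condition: packing and nets\<close>

locale local_poincare_space =
  fixes \<mu> :: "'a::metric_space measure" and f :: "real \<Rightarrow> real" and \<sigma> C r0 :: real
  assumes mms: "measured_metric_space \<mu>"
    and growth: "\<And>z r. r \<ge> 1/2 \<Longrightarrow> measure \<mu> (ball z r) / measure \<mu> (ball z (1/2)) \<le> f r"
    and \<sigma>: "\<sigma> \<ge> 1" and C: "C > 0" and r0: "r0 \<ge> 1"
    and poincare: "P_loc \<mu> \<sigma> C r0"
begin

lemmas ball_sets [measurable, simp] = measured_metric_space_ball(1)[OF mms]
lemmas ball_emeasure = measured_metric_space_ball(2)[OF mms]
lemmas ball_pos = measured_metric_space_ball(3)[OF mms]

lemma ball_measure_mono:
  assumes "dist w p + r \<le> r'"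
  shows "measure \<mu> (ball w r) \<le> measure \<mu> (ball p r')"
proof -
  have "ball w r \<subseteq> ball p r'"
    using assms by (rule ball_subset_ballI)
  then show ?thesis
    using ball_emeasure by (intro measure_mono_fmeasurable) (auto intro!: fmeasurableI)
qed

text \<open>Compares balls with different centres by enclosing the first in a ball about
  \<open>p\<close>. The growth condition enters the later arguments in this form.\<close>

lemma ball_measure_le:
  assumes "r' \<ge> 1/2" "dist w p + r \<le> r'"
  shows "measure \<mu> (ball w r) \<le> f r' * measure \<mu> (ball p (1/2))"
proof -
  have "measure \<mu> (ball w r) \<le> measure \<mu> (ball p r')"
    using assms by (intro ball_measure_mono)
  also have "\<dots> \<le> f r' * measure \<mu> (ball p (1/2))"
    using growth[OF assms(1), of p] ball_pos[of "1/2" p] by (simp add: field_simps)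
  finally show ?thesis .
qed

lemma growth_ge_1:
  assumes "r \<ge> 1/2"
  shows "f r \<ge> 1"
  \<comment> \<open>Any point would do as the centre; the half ball is compared with itself.\<close>
  using ball_measure_le[of r undefined undefined "1/2"] assms ball_pos[of "1/2" undefined] by simp

text \<open>Volume packing: the half balls about points of \<open>S\<close> are disjoint and lie in
  \<open>ball w (r + 1/2)\<close>, while each carries at least the fraction \<open>1/K\<close> of
  its measure.\<close>

lemma separated_card_le:
  fixes w :: 'a
  assumes "r > 0" "finite S" "S \<subseteq> ball w r"
    and sep: "\<And>p q. \<lbrakk>p \<in> S; q \<in> S; p \<noteq> q\<rbrakk> \<Longrightarrow> dist p q \<ge> 1"
  shows "real (card S) \<le> f (2 * r + 1/2)"
proof -
  define V where "V = measure \<mu> (ball w (r + 1/2))"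
  define K where "K = f (2 * r + 1/2)"
  have V: "V > 0" using assms ball_pos by (simp add: V_def)
  have K: "K \<ge> 1" using assms growth_ge_1 by (simp add: K_def)
  \<comment> \<open>Since \<open>dist w p < r\<close>, the ball defining \<open>V\<close> lies in
    the ball about \<open>p\<close> of radius \<open>r + (r + 1/2)\<close>.\<close>
  have "V \<le> K * measure \<mu> (ball p (1/2))" if "p \<in> S" for p
    unfolding V_def K_def using that assms by (intro ball_measure_le) (auto dest!: subsetD)
  then have "card S * V \<le> (\<Sum>p\<in>S. K * measure \<mu> (ball p (1/2)))"
    using sum_mono[of S "\<lambda>_. V"] by simp
  also have "\<dots> = K * (\<Sum>p\<in>S. measure \<mu> (ball p (1/2)))"
    by (simp add: sum_distrib_left)
  also have "(\<Sum>p\<in>S. measure \<mu> (ball p (1/2))) \<le> V"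
  proof -
    have disj: "disjoint_family_on (\<lambda>p. ball p (1/2)) S"
      unfolding disjoint_family_on_def
    proof (intro ballI impI, rule ccontr)
      fix p q assume pq: "p \<in> S" "q \<in> S" "p \<noteq> q" "ball p (1/2) \<inter> ball q (1/2) \<noteq> {}"
      then obtain y where "dist p y < 1/2" "dist q y < 1/2" by auto
      then show False
        using sep[OF pq(1-3)] dist_triangle[of p q y] by (simp add: dist_commute)
    qed
    have "ennreal (\<Sum>p\<in>S. measure \<mu> (ball p (1/2))) = (\<Sum>p\<in>S. emeasure \<mu> (ball p (1/2)))"
      by (simp add: ball_emeasure)
    also have "\<dots> = emeasure \<mu> (\<Union>p\<in>S. ball p (1/2))"
      using disj assms by (intro sum_emeasure) auto
    also have "\<dots> \<le> emeasure \<mu> (ball w (r + 1/2))"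
    proof (intro emeasure_mono subsetI)
      fix y assume "y \<in> (\<Union>p\<in>S. ball p (1/2))"
      then obtain p where "p \<in> S" "dist p y < 1/2" by auto
      then show "y \<in> ball w (r + 1/2)"
        using assms(3) dist_triangle[of w y p] by fastforce
    qed simp
    finally show ?thesis
      by (simp add: ball_emeasure V_def)
  qed
  finally show ?thesis
    using V K by (simp add: K_def)
qed

text \<open>The packing bound limits the size of separated sets, so one of greatest cardinality
  exists. A point it failed to cover could be added to it.\<close>

lemma separated_net_exists:
  fixes x :: 'a
  assumes "R > 0"
  obtains N where "finite N" "N \<subseteq> ball x R" "\<And>p q. \<lbrakk>p \<in> N; q \<in> N; p \<noteq> q\<rbrakk> \<Longrightarrow> dist p q \<ge> 1"
    "ball x R \<subseteq> (\<Union>p\<in>N. ball p 1)"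
proof -
  define P where "P N \<longleftrightarrow> finite N \<and> N \<subseteq> ball x R \<and> (\<forall>p\<in>N. \<forall>q\<in>N. p \<noteq> q \<longrightarrow> dist p q \<ge> 1)" for N
  have "card N \<le> nat \<lfloor>f (2 * R + 1/2)\<rfloor>" if "P N" for N
    using separated_card_le[OF assms, of N x] that by (simp add: P_def le_nat_floor)
  moreover have "P {}" by (simp add: P_def)
  ultimately have "\<exists>N. P N \<and> (\<forall>N'. P N' \<longrightarrow> card N' \<le> card N)"
    by (intro ex_has_greatest_nat[where b = "Suc (nat \<lfloor>f (2 * R + 1/2)\<rfloor>)"]) (auto simp: less_Suc_eq_le)
  then obtain N where N: "P N" and max: "\<And>N'. P N' \<Longrightarrow> card N' \<le> card N"
    by blast
  have "\<exists>p\<in>N. dist p y < 1" if y: "y \<in> ball x R" for y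
  proof (rule ccontr)
    assume *: "\<not> (\<exists>p\<in>N. dist p y < 1)"
    then have "y \<notin> N" by force
    moreover have "P (insert y N)"
      using * N y by (auto simp: P_def not_less dist_commute)
    ultimately show False
      using max[of "insert y N"] N by (simp add: P_def)
  qed
  then have "ball x R \<subseteq> (\<Union>p\<in>N. ball p 1)"
    by auto
  then show ?thesis
    using N that[of N] unfolding P_def by blast
qed

section \<open>Averages along chains of unit balls\<close>

context
  fixes u :: "'a \<Rightarrow> real" and g :: "'a \<Rightarrow> ennreal"
  assumes cont: "continuous_on UNIV u" and ug: "upper_gradient u g"
begin

definition energy :: "'a set \<Rightarrow> ennreal" where
  "energy A = (\<integral>\<^sup>+ y \<in> A. ennreal_powr (g y) \<sigma> \<partial>\<mu>)"

lemma u_measurable [measurable]: "u \<in> borel_measurable \<mu>"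
  using continuous_measurable_mms[OF mms cont] .

lemma g_powr_measurable [measurable]: "(\<lambda>y. ennreal_powr (g y) \<sigma>) \<in> borel_measurable \<mu>"
proof -
  have [measurable]: "g \<in> borel_measurable \<mu>"
    using ug mms by (simp add: upper_gradient_def measured_metric_space_def cong: measurable_cong_sets)
  show ?thesis
    unfolding ennreal_powr_def by measurable
qed

lemma energy_mono: "A \<subseteq> B \<Longrightarrow> energy A \<le> energy B"
  unfolding energy_def by (intro nn_integral_mono) (auto simp: indicator_def)

lemma poincare_unit_ball:
  "(\<integral>\<^sup>+ y \<in> ball z 1. ennreal (\<bar>u y - ball_avg \<mu> u z 1\<bar> powr \<sigma>) \<partial>\<mu>) \<le> ennreal C * energy (ball z 1)"
  using poincare cont ug r0 by (auto simp: P_loc_def energy_def)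

text \<open>On the half ball about the midpoint both averages are close to \<open>u\<close> by the
  local inequality. The point \<open>m\<close> is handed out so that its half ball can be compared
  with a larger ball.\<close>

lemma avg_diff_adjacent_le:
  assumes "dist z w \<le> 1"
  obtains m where "dist z m \<le> 1/2"
    "ennreal (\<bar>ball_avg \<mu> u z 1 - ball_avg \<mu> u w 1\<bar> powr \<sigma>) * emeasure \<mu> (ball m (1/2))
      \<le> ennreal (2 powr (\<sigma> - 1) * C) * (energy (ball z 1) + energy (ball w 1))"
proof -
  define d where "d = dist z w"
  obtain \<gamma> where \<gamma>: "geodesic_joining \<gamma> z w"
    using mms unfolding measured_metric_space_def by blast
  define m where "m = \<gamma> (d/2)"
  have d: "0 \<le> d" "d \<le> 1" using assms by (auto simp: d_def)
  then have "d/2 \<in> {0..dist z w}" "0 \<in> {0..dist z w}" "d \<in> {0..dist z w}"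
    by (auto simp: d_def)
  then have "dist (\<gamma> 0) (\<gamma> (d/2)) = \<bar>0 - d/2\<bar>" "dist (\<gamma> d) (\<gamma> (d/2)) = \<bar>d - d/2\<bar>"
    using \<gamma> unfolding geodesic_joining_def by blast+
  then have m: "dist z m \<le> 1/2" "dist w m \<le> 1/2"
    using \<gamma> d by (auto simp: geodesic_joining_def m_def d_def)
  have sub: "ball m (1/2) \<subseteq> ball z 1" "ball m (1/2) \<subseteq> ball w 1"
    using m by (auto intro!: ball_subset_ballI simp: dist_commute)
  let ?F = "\<lambda>A c. \<integral>\<^sup>+ y \<in> A. ennreal (\<bar>u y - c\<bar> powr \<sigma>) \<partial>\<mu>"
  have mono: "?F (ball m (1/2)) c \<le> ?F (ball v 1) c" if "ball m (1/2) \<subseteq> ball v 1" for v c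
    using that by (intro nn_integral_mono) (auto simp: indicator_def)
  have "ennreal (\<bar>ball_avg \<mu> u z 1 - ball_avg \<mu> u w 1\<bar> powr \<sigma>) * emeasure \<mu> (ball m (1/2))
    \<le> ennreal (2 powr (\<sigma> - 1)) * (?F (ball m (1/2)) (ball_avg \<mu> u z 1) + ?F (ball m (1/2)) (ball_avg \<mu> u w 1))"
    by (intro powr_emeasure_le \<sigma> u_measurable ball_sets)
  also have "\<dots> \<le> ennreal (2 powr (\<sigma> - 1)) * (ennreal C * energy (ball z 1) + ennreal C * energy (ball w 1))"
    using sub
    by (intro mult_left_mono add_mono order.trans[OF mono poincare_unit_ball]) auto
  also have "\<dots> = ennreal (2 powr (\<sigma> - 1) * C) * (energy (ball z 1) + energy (ball w 1))"
    using C by (simp add: ennreal_mult' distrib_left mult.assoc)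
  finally show ?thesis
    using m that by blast
qed

text \<open>Weighting by one fixed ball lets the steps of a chain be added, and later cancels
  against the total measure of the net balls.\<close>

lemma avg_diff_adjacent_in_ball_le:
  assumes R: "R \<ge> 0" and "dist z w \<le> 1" "dist x z \<le> R"
  shows "ennreal (\<bar>ball_avg \<mu> u z 1 - ball_avg \<mu> u w 1\<bar> powr \<sigma>) * emeasure \<mu> (ball x (R + 1))
      \<le> ennreal (f (2 * R + 2) * (2 powr (\<sigma> - 1) * C)) * (energy (ball z 1) + energy (ball w 1))"
proof -
  let ?t = "ennreal (\<bar>ball_avg \<mu> u z 1 - ball_avg \<mu> u w 1\<bar> powr \<sigma>)"
  obtain m where m: "dist z m \<le> 1/2"
    "?t * emeasure \<mu> (ball m (1/2))
      \<le> ennreal (2 powr (\<sigma> - 1) * C) * (energy (ball z 1) + energy (ball w 1))"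
    using avg_diff_adjacent_le[OF assms(2)] .
  have f: "f (2 * R + 2) \<ge> 1" using R by (intro growth_ge_1) auto
  \<comment> \<open>As \<open>dist x m \<le> R + 1/2\<close>, the radius \<open>2 * R + 3/2\<close>
    about \<open>m\<close> would already suffice.\<close>
  have "measure \<mu> (ball x (R + 1)) \<le> f (2 * R + 2) * measure \<mu> (ball m (1/2))"
    using m(1) assms dist_triangle[of x m z] by (intro ball_measure_le) auto
  then have "emeasure \<mu> (ball x (R + 1)) \<le> ennreal (f (2 * R + 2)) * emeasure \<mu> (ball m (1/2))"
    using f by (simp add: ball_emeasure ennreal_leI flip: ennreal_mult')
  then have "?t * emeasure \<mu> (ball x (R + 1)) \<le> ?t * (ennreal (f (2 * R + 2)) * emeasure \<mu> (ball m (1/2)))"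
    by (intro mult_left_mono) auto
  also have "\<dots> = ennreal (f (2 * R + 2)) * (?t * emeasure \<mu> (ball m (1/2)))"
    by (simp add: mult_ac)
  also have "\<dots> \<le> ennreal (f (2 * R + 2)) * (ennreal (2 powr (\<sigma> - 1) * C) * (energy (ball z 1) + energy (ball w 1)))"
    by (intro mult_left_mono m) auto
  finally show ?thesis
    using f by (simp add: ennreal_mult' mult.assoc)
qed

lemma avg_diff_le:
  assumes R: "R \<ge> 1" and p: "dist x p < R"
  shows "ennreal (\<bar>ball_avg \<mu> u p 1 - ball_avg \<mu> u x 1\<bar> powr \<sigma>) * emeasure \<mu> (ball x (R + 1))
    \<le> ennreal (5 * f (2 * R + 2) * 2 powr (2 * \<sigma> - 2) * R powr (\<sigma> - 1) * C) * energy (ball x (R + 1))"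
proof -
  define d where "d = dist x p"
  obtain \<gamma> where \<gamma>: "geodesic_joining \<gamma> x p"
    using mms unfolding measured_metric_space_def by blast
  \<comment> \<open>Unit steps, the last one cut off at \<open>d\<close> by the minimum in
    \<open>t\<close>; since \<open>n > d\<close>, the chain ends exactly at
    \<open>p\<close>.\<close>
  define n where "n = nat \<lfloor>d\<rfloor> + 1"
  define t where "t k = min (real k) d" for k :: nat
  define z where "z k = \<gamma> (t k)" for k
  define F where "F k = ball_avg \<mu> u (z k) 1" for k
  define G where "G = energy (ball x (R + 1))"
  define K where "K = f (2 * R + 2) * (2 powr (\<sigma> - 1) * C)"
  have d: "0 \<le> d" "d < R" using p by (auto simp: d_def)
  have n: "d < real n" "real n \<le> d + 1"
    using d by (auto simp: n_def) linarith+
  have tk: "t k = real k" if "k < n" for k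
    using that d by (auto simp: t_def n_def) linarith
  have t: "t k \<in> {0..dist x p}" for k
    using d by (auto simp: t_def d_def)
  have z0: "z 0 = x" and zn: "z n = p"
    using \<gamma> n d by (auto simp: z_def t_def geodesic_joining_def d_def min_def)
  have dz: "dist (z j) (z k) = \<bar>t j - t k\<bar>" for j k
    using \<gamma> t unfolding z_def geodesic_joining_def by blast
  have dx: "dist x (z k) \<le> d" for k
    using dz[of 0 k] d by (simp add: z0 t_def)
  have subset: "ball (z k) 1 \<subseteq> ball x (R + 1)" for k
    using dx[of k] d by (intro ball_subset_ballI) (simp add: dist_commute)
  have K: "K \<ge> 0"
    using R C growth_ge_1[of "2 * R + 2"] by (simp add: K_def)

  have step: "ennreal (\<bar>F (Suc k) - F k\<bar> powr \<sigma>) * emeasure \<mu> (ball x (R + 1))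
      \<le> ennreal K * (energy (ball (z k) 1) + energy (ball (z (Suc k)) 1))" for k
    using avg_diff_adjacent_in_ball_le[of R "z k" "z (Suc k)" x] R dx[of k] d dz[of k "Suc k"]
    by (simp add: F_def K_def t_def abs_minus_commute)

  \<comment> \<open>The endpoint \<open>z n\<close> is left out: below \<open>n\<close> the
    parameters are the integers \<open>k\<close> themselves. Centres whose unit balls share a point
    are less than 2 apart, so their indices differ by at most 1.\<close>
  have overlap: "(\<Sum>k<n. energy (ball (z k) 1)) \<le> ennreal 2 * G"
    unfolding energy_def G_def
  proof (intro sum_nn_integral_overlap_le)
    fix w
    define S where "S = {k\<in>{..<n}. w \<in> ball (z k) 1}"
    have close: "k \<le> Suc j" if "j \<in> S" "k \<in> S" for j k
    proof -
      have "dist (z j) (z k) < 2"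
        using that dist_triangle[of "z j" "z k" w] by (simp add: S_def dist_commute)
      then show ?thesis
        using that by (simp add: dz tk S_def)
    qed
    have "finite S" by (simp add: S_def)
    \<comment> \<open>If \<open>S\<close> is empty, \<open>Min S\<close> is an unspecified number
      and the inclusion is vacuous.\<close>
    have "S \<subseteq> {Min S, Suc (Min S)}"
    proof
      fix k assume k: "k \<in> S"
      then have "Min S \<in> S" "Min S \<le> k"
        using \<open>finite S\<close> by (auto intro: Min_in)
      with close[of "Min S" k] k show "k \<in> {Min S, Suc (Min S)}" by auto
    qed
    then have "card S \<le> card {Min S, Suc (Min S)}"
      by (intro card_mono) auto
    then show "real (card {k\<in>{..<n}. w \<in> ball (z k) 1}) \<le> 2"
      by (simp add: S_def)
  qed (use subset in auto)
  \<comment> \<open>The shifted sum also contains the endpoint ball, bounded separately by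
    \<open>G\<close>. The two sums thus give 2 + 3 = 5.\<close>
  have "(\<Sum>k<n. energy (ball (z (Suc k)) 1)) \<le> (\<Sum>k<Suc n. energy (ball (z k) 1))"
    by (subst sum.lessThan_Suc_shift) simp
  also have "\<dots> \<le> ennreal 2 * G + G"
    using overlap energy_mono[OF subset[of n]] by (simp add: G_def add_mono)
  finally have sum_energy: "(\<Sum>k<n. energy (ball (z k) 1) + energy (ball (z (Suc k)) 1)) \<le> ennreal 2 * G + (ennreal 2 * G + G)"
    using overlap by (simp add: sum.distrib add_mono)
  have five: "ennreal 2 * G + (ennreal 2 * G + G) = ennreal 5 * G"
    by (metis (no_types, lifting) ennreal_numeral distrib_right mult_1 numeral_One numeral_plus_numeral add_num_simps add.assoc)

  have "\<bar>F n - F 0\<bar> powr \<sigma> \<le> (\<Sum>k<n. \<bar>F (Suc k) - F k\<bar>) powr \<sigma>"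
    using \<sigma> by (intro powr_mono2) (auto simp flip: sum_lessThan_telescope)
  also have "\<dots> \<le> real n powr (\<sigma> - 1) * (\<Sum>k<n. \<bar>F (Suc k) - F k\<bar> powr \<sigma>)"
    using powr_sum_le[OF \<sigma>, of "{..<n}"] by simp
  \<comment> \<open>The number of steps satisfies \<open>n \<le> d + 1 < R + 1 \<le> 2 * R\<close>,
    by \<open>R \<ge> 1\<close>.\<close>
  also have "\<dots> \<le> (2 * R) powr (\<sigma> - 1) * (\<Sum>k<n. \<bar>F (Suc k) - F k\<bar> powr \<sigma>)"
    using n d R \<sigma> by (intro mult_right_mono powr_mono2 sum_nonneg) auto
  finally have "ennreal (\<bar>F n - F 0\<bar> powr \<sigma>)
      \<le> ennreal ((2 * R) powr (\<sigma> - 1)) * (\<Sum>k<n. ennreal (\<bar>F (Suc k) - F k\<bar> powr \<sigma>))"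
    by (simp add: ennreal_leI flip: ennreal_mult')
  then have "ennreal (\<bar>F n - F 0\<bar> powr \<sigma>) * emeasure \<mu> (ball x (R + 1))
      \<le> ennreal ((2 * R) powr (\<sigma> - 1)) * (\<Sum>k<n. ennreal (\<bar>F (Suc k) - F k\<bar> powr \<sigma>))
        * emeasure \<mu> (ball x (R + 1))"
    by (intro mult_right_mono) auto
  also have "\<dots> = ennreal ((2 * R) powr (\<sigma> - 1))
      * (\<Sum>k<n. ennreal (\<bar>F (Suc k) - F k\<bar> powr \<sigma>) * emeasure \<mu> (ball x (R + 1)))"
    by (simp only: sum_distrib_right mult.assoc)
  also have "\<dots> \<le> ennreal ((2 * R) powr (\<sigma> - 1))
      * (\<Sum>k<n. ennreal K * (energy (ball (z k) 1) + energy (ball (z (Suc k)) 1)))"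
    by (intro mult_left_mono sum_mono step) auto
  also have "\<dots> \<le> ennreal ((2 * R) powr (\<sigma> - 1)) * (ennreal K * (ennreal 5 * G))"
    using sum_energy unfolding sum_distrib_left[symmetric] five
    by (intro mult_left_mono) auto
  also have "\<dots> = ennreal ((2 * R) powr (\<sigma> - 1) * (K * 5)) * G"
    using K by (simp add: ennreal_mult' mult.assoc)
  also have "(2 * R) powr (\<sigma> - 1) * (K * 5) = 5 * f (2 * R + 2) * 2 powr (2 * \<sigma> - 2) * R powr (\<sigma> - 1) * C"
    using R by (simp add: K_def powr_mult powr_add[symmetric] mult_ac)
  finally show ?thesis
    by (simp add: F_def G_def z0 zn)
qed

section \<open>From unit balls to a large ball\<close>

lemma deviation_from_unit_avg_le:
  assumes R: "R \<ge> 1"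
  shows "(\<integral>\<^sup>+ y \<in> ball x R. ennreal (\<bar>u y - ball_avg \<mu> u x 1\<bar> powr \<sigma>) \<partial>\<mu>)
    \<le> ennreal (2 powr (\<sigma> - 1) * f (5/2) * (C + 5 * f (2 * R + 2) * 2 powr (2 * \<sigma> - 2) * R powr (\<sigma> - 1) * C))
      * energy (ball x (R + 1))"
proof -
  define B where "B = ball x (R + 1)"
  define c where "c = ball_avg \<mu> u x 1"
  define Q where "Q = 5 * f (2 * R + 2) * 2 powr (2 * \<sigma> - 2) * R powr (\<sigma> - 1) * C"
  \<comment> \<open>A bound for \<open>\<bar>ball_avg \<mu> u p 1 - c\<bar> powr \<sigma>\<close>
    common to all net points \<open>p\<close>. The division by \<open>emeasure \<mu> B\<close> is
    undone once the measures of the net balls have been summed.\<close>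
  define q where "q = ennreal Q * energy B / emeasure \<mu> B"
  define h where "h y = ennreal (\<bar>u y - c\<bar> powr \<sigma>)" for y
  have h [measurable]: "h \<in> borel_measurable \<mu>"
    unfolding h_def by measurable
  have "R > 0" using R by simp
  obtain N where N: "finite N" "N \<subseteq> ball x R" "\<And>p q. \<lbrakk>p \<in> N; q \<in> N; p \<noteq> q\<rbrakk> \<Longrightarrow> dist p q \<ge> 1"
    "ball x R \<subseteq> (\<Union>p\<in>N. ball p 1)"
    by (rule separated_net_exists[OF \<open>R > 0\<close>, of x]) blast
  have B: "0 < emeasure \<mu> B" "emeasure \<mu> B < top"
    using ball_pos[of "R + 1" x] R by (auto simp: B_def ball_emeasure)
  have qB: "q * emeasure \<mu> B = ennreal Q * energy B"
    using B by (simp add: q_def ennreal_divide_times)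
  have Q: "Q \<ge> 0" using C growth_ge_1[of "2 * R + 2"] R by (simp add: Q_def)
  have f: "f (5/2) \<ge> 1" by (intro growth_ge_1) auto
  have subset: "ball p 1 \<subseteq> B" if "p \<in> N" for p
    using N(2) that unfolding B_def by (intro ball_subset_ballI) (auto simp: dist_commute)
  \<comment> \<open>The net points whose unit balls contain \<open>w\<close> form a 1-separated
    subset of \<open>ball w 1\<close>; packing with \<open>r = 1\<close> gives the radius
    \<open>5/2\<close>.\<close>
  have overlap: "real (card {p\<in>N. w \<in> ball p 1}) \<le> f (5/2)" for w
  proof -
    have "{p\<in>N. w \<in> ball p 1} \<subseteq> ball w 1"
      by (auto simp: dist_commute)
    then show ?thesis
      using separated_card_le[of 1 "{p\<in>N. w \<in> ball p 1}" w] N(1,3) by simp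
  qed
  have piece: "(\<integral>\<^sup>+ y \<in> ball p 1. h y \<partial>\<mu>)
      \<le> ennreal (2 powr (\<sigma> - 1)) * (ennreal C * energy (ball p 1) + q * emeasure \<mu> (ball p 1))"
    if "p \<in> N" for p
  proof -
    have "dist x p < R" using that N(2) by auto
    then have "ennreal (\<bar>ball_avg \<mu> u p 1 - c\<bar> powr \<sigma>) * emeasure \<mu> B \<le> ennreal Q * energy B"
      using avg_diff_le[OF R] by (simp add: c_def B_def Q_def)
    then have "ennreal (\<bar>ball_avg \<mu> u p 1 - c\<bar> powr \<sigma>) \<le> q"
      using B divide_right_mono_ennreal[of _ _ "emeasure \<mu> B"]
      unfolding q_def by (metis ennreal_mult_divide_eq less_irrefl mult.commute)
    then show ?thesis
      unfolding h_def
      by (intro order.trans[OF set_nn_integral_powr_le[OF \<sigma> u_measurable ball_sets,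
              where c = "ball_avg \<mu> u p 1"]]
          mult_left_mono add_mono poincare_unit_ball mult_right_mono) auto
  qed
  have "(\<integral>\<^sup>+ y \<in> ball x R. h y \<partial>\<mu>) \<le> (\<integral>\<^sup>+ y. (\<Sum>p\<in>N. h y * indicator (ball p 1) y) \<partial>\<mu>)"
  proof (intro nn_integral_mono)
    fix y
    show "h y * indicator (ball x R) y \<le> (\<Sum>p\<in>N. h y * indicator (ball p 1) y)"
    proof (cases "y \<in> ball x R")
      case True
      then obtain p where "p \<in> N" "y \<in> ball p 1" using N(4) by blast
      then show ?thesis
        using member_le_sum[of p N "\<lambda>p. h y * indicator (ball p 1) y"] N(1) True by simp
    qed simp
  qed
  also have "\<dots> = (\<Sum>p\<in>N. \<integral>\<^sup>+ y \<in> ball p 1. h y \<partial>\<mu>)"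
    by (intro nn_integral_sum) auto
  also have "\<dots> \<le> (\<Sum>p\<in>N. ennreal (2 powr (\<sigma> - 1)) * (ennreal C * energy (ball p 1) + q * emeasure \<mu> (ball p 1)))"
    by (intro sum_mono piece)
  also have "\<dots> = ennreal (2 powr (\<sigma> - 1))
      * (ennreal C * (\<Sum>p\<in>N. energy (ball p 1)) + q * (\<Sum>p\<in>N. emeasure \<mu> (ball p 1)))"
    by (simp add: sum.distrib flip: sum_distrib_left)
  also have "\<dots> \<le> ennreal (2 powr (\<sigma> - 1))
      * (ennreal C * (ennreal (f (5/2)) * energy B) + q * (ennreal (f (5/2)) * emeasure \<mu> B))"
  proof (intro mult_left_mono add_mono)
    show "(\<Sum>p\<in>N. energy (ball p 1)) \<le> ennreal (f (5/2)) * energy B"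
      unfolding energy_def using N(1) subset overlap
      by (intro sum_nn_integral_overlap_le) (auto simp: B_def)
    show "(\<Sum>p\<in>N. emeasure \<mu> (ball p 1)) \<le> ennreal (f (5/2)) * emeasure \<mu> B"
      using sum_nn_integral_overlap_le[of N "\<lambda>_. 1" \<mu> B "\<lambda>p. ball p 1" "f (5/2)"] N(1) subset overlap
      by (simp add: B_def)
  qed auto
  also have "q * (ennreal (f (5/2)) * emeasure \<mu> B) = ennreal (f (5/2)) * (ennreal Q * energy B)"
    by (simp only: qB[symmetric] mult_ac)
  also have "ennreal (2 powr (\<sigma> - 1))
      * (ennreal C * (ennreal (f (5/2)) * energy B) + ennreal (f (5/2)) * (ennreal Q * energy B))
      = ennreal (2 powr (\<sigma> - 1) * f (5/2) * (C + Q)) * energy B"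
    using f C Q by (simp add: ennreal_mult' ennreal_plus algebra_simps)
  finally show ?thesis
    by (simp add: h_def c_def B_def Q_def)
qed

text \<open>Replacing \<open>c\<close> by the average over \<open>ball x R\<close> adds a term that
  Jensen's inequality bounds by \<open>E\<close> itself, so the total factor is
  \<open>2 powr (\<sigma> - 1) * 2\<close>.\<close>

lemma poincare_large_ball:
  assumes R: "R \<ge> 1"
  shows "(\<integral>\<^sup>+ y \<in> ball x R. ennreal (\<bar>u y - ball_avg \<mu> u x R\<bar> powr \<sigma>) \<partial>\<mu>)
    \<le> ennreal (6 * 2 powr (4 * \<sigma> - 3) * f (5/2) * C * R powr (\<sigma> - 1) * f (2 * R + 2))
      * energy (ball x (R + 1))"
proof -
  define c where "c = ball_avg \<mu> u x 1"
  define E where "E = (\<integral>\<^sup>+ y \<in> ball x R. ennreal (\<bar>u y - c\<bar> powr \<sigma>) \<partial>\<mu>)"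
  define L where "L = f (2 * R + 2) * 2 powr (2 * \<sigma> - 2) * R powr (\<sigma> - 1)"
  define A where "A = 2 powr (\<sigma> - 1) * f (5/2) * (C + 5 * L * C)"
  have f: "f (5/2) \<ge> 1" "f (2 * R + 2) \<ge> 1"
    using R by (auto intro!: growth_ge_1)
  have L: "L \<ge> 1"
    using f(2) R \<sigma> unfolding L_def by (intro mult_ge1_I ge_one_powr_ge_zero) auto
  have A: "A \<ge> 0" using f L C by (simp add: A_def)
  have E: "E \<le> ennreal A * energy (ball x (R + 1))"
    using deviation_from_unit_avg_le[OF R, of x] by (simp add: E_def c_def A_def L_def mult_ac)
  have "(\<integral>\<^sup>+ y \<in> ball x R. ennreal (\<bar>u y - ball_avg \<mu> u x R\<bar> powr \<sigma>) \<partial>\<mu>)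
      \<le> ennreal (2 powr (\<sigma> - 1)) * (E + ennreal (\<bar>c - ball_avg \<mu> u x R\<bar> powr \<sigma>) * emeasure \<mu> (ball x R))"
    unfolding E_def by (intro set_nn_integral_powr_le \<sigma>) auto
  also have "ennreal (\<bar>c - ball_avg \<mu> u x R\<bar> powr \<sigma>) * emeasure \<mu> (ball x R) \<le> E"
    using ball_avg_deviation_powr_le[OF mms cont \<sigma>, of R x c] R
    by (simp add: E_def ball_emeasure abs_minus_commute mult.commute flip: ennreal_mult')
  also have "E + E = ennreal 2 * E"
    by (simp add: mult_2)
  also have "ennreal (2 powr (\<sigma> - 1)) * (ennreal 2 * E) = ennreal (2 powr (\<sigma> - 1) * 2) * E"
    by (simp only: ennreal_mult' mult.assoc powr_ge_zero)
  also have "\<dots> = ennreal (2 powr \<sigma>) * E"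
    by (simp add: powr_diff)
  also have "\<dots> \<le> ennreal (2 powr \<sigma>) * (ennreal A * energy (ball x (R + 1)))"
    by (intro mult_left_mono E) auto
  also have "\<dots> = ennreal (2 powr \<sigma> * A) * energy (ball x (R + 1))"
    using A by (simp add: ennreal_mult' mult.assoc)
  also have "\<dots> \<le> ennreal (6 * 2 powr (4 * \<sigma> - 3) * f (5/2) * C * R powr (\<sigma> - 1) * f (2 * R + 2))
      * energy (ball x (R + 1))"
  proof (intro mult_right_mono ennreal_leI)
    \<comment> \<open>By \<open>L \<ge> 1\<close>, the summand \<open>C\<close> is absorbed into
      \<open>L * C\<close>, turning 5 into 6.\<close>
    have "2 powr \<sigma> * A \<le> 2 powr \<sigma> * (2 powr (\<sigma> - 1) * f (5/2) * (6 * L * C))"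
      unfolding A_def using f C L by (intro mult_left_mono) auto
    also have "\<dots> = 6 * (2 powr \<sigma> * 2 powr (\<sigma> - 1) * 2 powr (2 * \<sigma> - 2)) * f (5/2) * C * R powr (\<sigma> - 1) * f (2 * R + 2)"
      by (simp add: L_def mult_ac)
    also have "2 powr \<sigma> * 2 powr (\<sigma> - 1) * 2 powr (2 * \<sigma> - 2) = (2::real) powr (4 * \<sigma> - 3)"
      by (simp flip: powr_add)
    finally show "2 powr \<sigma> * A \<le> 6 * 2 powr (4 * \<sigma> - 3) * f (5/2) * C * R powr (\<sigma> - 1) * f (2 * R + 2)" .
  qed auto
  finally show ?thesis by (simp add: mult_left_mono add_left_mono)
qed

end

end

section \<open>Comparison with the stated constants\<close>

theorem theorem1p1:
  fixes \<mu> :: "'a::metric_space measure"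
    and f :: "real \<Rightarrow> real"
    and \<sigma> C r0 lam C0 R :: real
    and u :: "'a \<Rightarrow> real"
    and g :: "'a \<Rightarrow> ennreal"
    and x :: 'a
  assumes "measured_metric_space \<mu>"
    and "mono_on {0<..} f"
    and "\<And>z r. r \<ge> 1/2 \<Longrightarrow> measure \<mu> (ball z r) / measure \<mu> (ball z (1/2)) \<le> f r"
    and "\<sigma> \<ge> 1" and "C > 0" and "r0 \<ge> 1"
    and "P_loc \<mu> \<sigma> C r0"
    and "lam = f (8.5) + 1"
    and "C0 = 2 powr (4 * \<sigma> - 2) * lam ^ 3 * f (12.5) * C"
    and "continuous_on UNIV u"
    and "upper_gradient u g"
    and "R \<ge> 4 * lam"
  shows "(\<integral>\<^sup>+ y \<in> ball x R. ennreal (\<bar>u y - ball_avg \<mu> u x R\<bar> powr \<sigma>) \<partial>\<mu>)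
    \<le> ennreal (C0 * R powr (\<sigma> - 1) * f (4 * lam * R))
        * (\<integral>\<^sup>+ y \<in> ball x (2 * lam * R). ennreal_powr (g y) \<sigma> \<partial>\<mu>)"
proof -
  interpret local_poincare_space \<mu> f \<sigma> C r0
    using assms by unfold_locales auto
  have f: "f (8.5) \<ge> 1" "f (12.5) \<ge> 1" "f (5/2) \<ge> 1" "f (5/2) \<le> f (8.5)"
    by (auto intro!: growth_ge_1 mono_onD[OF assms(2)])
  then have lam: "lam \<ge> 2" and R: "R \<ge> 8"
    using assms by auto
  have lamR: "2 * R \<le> lam * R"
    using lam R by (intro mult_right_mono) auto
  then have "2 * R + 2 \<le> 4 * lam * R"
    using R by (simp only: mult.assoc)
  \<comment> \<open>Monotonicity carries the value of \<open>f\<close> at the radius produced by the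
    chain argument over to the stated radius.\<close>
  then have fR: "1 \<le> f (2 * R + 2)" "f (2 * R + 2) \<le> f (4 * lam * R)"
    using R lam by (auto intro: growth_ge_1 mono_onD[OF assms(2)])
  \<comment> \<open>Because \<open>6 * 2 powr (4 * \<sigma> - 3)\<close> equals
    \<open>3 * 2 powr (4 * \<sigma> - 2)\<close>, this is the remaining comparison. It uses
    \<open>f (5/2) \<le> lam - 1\<close> and \<open>lam \<ge> 2\<close>, whence
    \<open>lam ^ 3 \<ge> 4 * lam\<close>.\<close>
  have lam3: "3 * f (5/2) \<le> lam ^ 3 * f (12.5)"
  proof -
    have "2 * 2 * lam \<le> lam * lam * lam"
      using lam by (intro mult_right_mono mult_mono) auto
    moreover have "lam ^ 3 * 1 \<le> lam ^ 3 * f (12.5)"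
      using lam f by (intro mult_left_mono) auto
    moreover have "3 * f (5/2) \<le> 4 * lam"
      using f assms(8) by linarith
    ultimately show ?thesis
      unfolding power3_eq_cube by linarith
  qed
  have "2 powr (4 * \<sigma> - 2) * C * R powr (\<sigma> - 1) * (3 * f (5/2) * f (2 * R + 2))
      \<le> 2 powr (4 * \<sigma> - 2) * C * R powr (\<sigma> - 1) * (lam ^ 3 * f (12.5) * f (4 * lam * R))"
    using f fR lam assms(5) by (intro mult_left_mono mult_mono[OF lam3]) auto
  moreover have "2 powr (4 * \<sigma> - 2) = 2 * 2 powr (4 * \<sigma> - 3)"
    using powr_mult_base[of 2 "4 * \<sigma> - 3"] by simp
  ultimately have const: "6 * 2 powr (4 * \<sigma> - 3) * f (5/2) * C * R powr (\<sigma> - 1) * f (2 * R + 2)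
      \<le> C0 * R powr (\<sigma> - 1) * f (4 * lam * R)"
    unfolding assms(9) by (simp add: mult_ac)
  have "ball x (R + 1) \<subseteq> ball x (2 * lam * R)"
    using lamR R by (intro subset_ball) (simp only: mult.assoc)
  note energy_le = energy_mono[OF assms(10,11) this]
  have "(\<integral>\<^sup>+ y \<in> ball x R. ennreal (\<bar>u y - ball_avg \<mu> u x R\<bar> powr \<sigma>) \<partial>\<mu>)
    \<le> ennreal (6 * 2 powr (4 * \<sigma> - 3) * f (5/2) * C * R powr (\<sigma> - 1) * f (2 * R + 2))
      * energy g (ball x (R + 1))"
    using R by (intro poincare_large_ball[OF assms(10,11)]) simp
  also have "\<dots> \<le> ennreal (C0 * R powr (\<sigma> - 1) * f (4 * lam * R)) * energy g (ball x (2 * lam * R))"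
    by (intro mult_mono ennreal_leI const energy_le) auto
  finally show ?thesis
    by (simp only: energy_def[OF assms(10,11)])
qed

end
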